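(* For all positive integers $m,n$ and all real $x$, $$E_{m+n+1}(x)=\frac{\binom{m+n}{m}(m+n+1)}{2}\left(\int_0^1 E_m(x-t)E_n(t)\,dt-2\int_x^1 (x-t)^m E_n(t)\,dt\right),$$ and, for $y>0$, $$\frac{y^mE_m\left(\frac{x}{y}\right)}{2\,m!}\ast\frac{y^nE_n\left(\frac{x}{y}\right)}{2\,n!}=\frac{y^{m+n+1}E_{m+n+1}\left(\frac{x}{y}\right)}{2\,(m+n+1)!}.$$
   Context: The Euler polynomials $E_k(x)$ are defined by $\frac{2e^{xt}}{e^t+1}=\sum_{k\ge0}E_k(x)\frac{t^k}{k!}$. For functions $g(x,y),h(x,y)$ ($x\in\mathbb{R}$, $y>0$) the operation $\ast$ is defined by $g\ast h(x,y)=\int_0^x g(t,y)h(x-t,y)\,dt-\int_x^y g(t,y)h(x+y-t,y)\,dt$. *)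

theory Defs
  imports "HOL-Analysis.Analysis" "HOL-Computational_Algebra.Formal_Power_Series"
begin

text \<open>The exponential generating function is read as a formal power series in $t$;
  division makes sense because the constant term of $e^t + 1$ is $2 \neq 0$.\<close>

definition euler_poly :: "nat \<Rightarrow> real \<Rightarrow> real" where
  "euler_poly k x = fact k * fps_nth (2 * fps_exp x / (fps_exp 1 + 1)) k"

lemma euler_poly_generating_function:
  "Abs_fps (\<lambda>k. euler_poly k x / fact k) = 2 * fps_exp x / (fps_exp 1 + 1)"
  by (rule fps_ext) (simp add: euler_poly_def)

lemma euler_poly_generating_function_mult:
  "Abs_fps (\<lambda>k. euler_poly k x / fact k) * (fps_exp 1 + 1) = 2 * fps_exp x"
proof -
  have "fps_nth (fps_exp 1 + 1 :: real fps) 0 \<noteq> 0"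
    by simp
  then have "(fps_exp 1 + 1 :: real fps) dvd 2 * fps_exp x"
    by (meson fps_is_unit_iff unit_imp_dvd)
  then show ?thesis
    unfolding euler_poly_generating_function by simp
qed

text \<open>The integrals \<open>LBINT t=a..b. f t\<close> are oriented (a sign change when \<open>b < a\<close>), which
  matters because \<open>x\<close> is not assumed to lie in \<open>[0, y]\<close>.\<close>

definition ast_op ::
  "(real \<Rightarrow> real \<Rightarrow> real) \<Rightarrow> (real \<Rightarrow> real \<Rightarrow> real) \<Rightarrow> real \<Rightarrow> real \<Rightarrow> real"
  (infixl "\<star>" 70) where
  "(g \<star> h) x y =
     (LBINT t=0..x. g t y * h (x - t) y) - (LBINT t=x..y. g t y * h (x + y - t) y)"

end

theory Submission
  imports Defs
begin

text \<open>Put \<open>b k x = y ^ k * E k (x / y) / k!\<close>. Then \<open>b (k + 1)\<close> is an antiderivative of \<open>b k\<close>, and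
  \<open>b k (x + y) + b k x = 2 * x ^ k / k!\<close>. Integrating both terms of
  \<open>(\<integral>t=0..y. b m (x - t) * b n t) - 2 * (\<integral>t=x..y. (x - t) ^ m / m! * b n t)\<close> by parts moves
  one index from \<open>m\<close> to \<open>n\<close>; the functional equation makes the boundary terms cancel. So the
  expression depends on \<open>m + n\<close> only, and for \<open>m = 0\<close> it equals \<open>2 * b (n + 1) x\<close>. The case \<open>y = 1\<close> is the
  first identity, and replacing \<open>b n (x + y - t)\<close> by \<open>2 * (x - t) ^ n / n! - b n (x - t)\<close> in the
  definition of the operation yields the second.\<close>

definition scaled_euler :: "real \<Rightarrow> nat \<Rightarrow> real \<Rightarrow> real" where
  "scaled_euler y k x = y ^ k * euler_poly k (x / y) / fact k"

section \<open>Euler polynomials: expansion, functional equation, derivative\<close>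

text \<open>Cauchy product of \<open>fps_exp x\<close> with the series 2/(e^t + 1), which is free of
  \<open>x\<close>; this form can be differentiated termwise.\<close>

lemma euler_poly_expansion:
  "euler_poly k x / fact k =
     (\<Sum>i=0..k. x ^ i / fact i * fps_nth (2 * inverse (fps_exp 1 + 1)) (k - i))"
proof -
  have "2 * fps_exp x / (fps_exp 1 + 1) = fps_exp x * (2 * inverse (fps_exp 1 + 1 :: real fps))"
    by (simp add: fps_divide_unit algebra_simps)
  then show ?thesis
    by (simp add: euler_poly_def fps_mult_nth fps_exp_nth)
qed

lemma euler_poly_0 [simp]: "euler_poly 0 x = 1"
  using euler_poly_expansion[of 0 x] by (simp add: fps_mult_nth)

text \<open>Since e^((x+1)t) + e^(xt) = e^(xt) (e^t + 1), adding the two generating functions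
  cancels the denominator.\<close>

lemma euler_poly_shift_add: "euler_poly k (x + 1) + euler_poly k x = 2 * x ^ k"
proof -
  define A :: "real \<Rightarrow> real fps" where "A = (\<lambda>x. Abs_fps (\<lambda>k. euler_poly k x / fact k))"
  have gf: "A z * (fps_exp 1 + 1) = 2 * fps_exp z" for z
    unfolding A_def by (rule euler_poly_generating_function_mult)
  have "(A (x + 1) + A x) * (fps_exp 1 + 1) = 2 * fps_exp x * (fps_exp 1 + 1)"
    using gf[of "x + 1"] gf[of x] by (simp add: fps_exp_add_mult algebra_simps)
  moreover have "(fps_exp 1 + 1 :: real fps) \<noteq> 0"
    by (rule fps_nonzeroI[of _ 0]) simp
  ultimately have "A (x + 1) + A x = 2 * fps_exp x"
    by simp
  then have "fps_nth (A (x + 1) + A x) k = fps_nth (2 * fps_exp x) k"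
    by simp
  then show ?thesis
    by (simp add: A_def fps_numeral_simps flip: add_divide_distrib)
qed

lemma has_real_derivative_power_div_fact:
  "((\<lambda>x. x ^ Suc k / fact (Suc k)) has_real_derivative x ^ k / fact k) (at x)"
  using DERIV_cdivide[OF DERIV_pow[of "Suc k" x], of "fact (Suc k)"]
  by (simp del: of_nat_Suc)

text \<open>The Appell property: the coefficients in the expansion depend only on
  \<open>k - i\<close>, so lowering both indices by one leaves them unchanged.\<close>

lemma has_real_derivative_euler_poly:
  "((\<lambda>x. euler_poly (Suc k) x / fact (Suc k)) has_real_derivative euler_poly k x / fact k) (at x)"
proof -
  define c where "c = fps_nth (2 * inverse (fps_exp 1 + 1 :: real fps))"
  have "((\<lambda>x. \<Sum>i=0..k. x ^ Suc i / fact (Suc i) * c (k - i)) has_real_derivative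
          (\<Sum>i=0..k. x ^ i / fact i * c (k - i))) (at x)"
    by (intro DERIV_sum DERIV_cmult_right has_real_derivative_power_div_fact)
  then have "((\<lambda>x. c (Suc k) + (\<Sum>i=0..k. x ^ Suc i / fact (Suc i) * c (k - i)))
      has_real_derivative (\<Sum>i=0..k. x ^ i / fact i * c (k - i))) (at x)"
    using DERIV_add[OF DERIV_const] by fastforce
  \<comment> \<open>The term \<open>i = 0\<close> is the constant \<open>c (Suc k)\<close>; the
    others are reindexed by \<open>Suc i\<close>.\<close>
  moreover have "euler_poly (Suc k) z / fact (Suc k) =
      c (Suc k) + (\<Sum>i=0..k. z ^ Suc i / fact (Suc i) * c (k - i))" for z
    unfolding euler_poly_expansion c_def
    by (subst sum.atLeast0_atMost_Suc_shift) simp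
  ultimately show ?thesis
    by (simp only: euler_poly_expansion[of k] c_def)
qed

section \<open>Scaled Euler polynomials\<close>

lemma scaled_euler_0 [simp]: "scaled_euler y 0 x = 1"
  by (simp add: scaled_euler_def)

context
  fixes y :: real
  assumes y: "y \<noteq> 0"
begin

lemma scaled_euler_shift_add:
  "scaled_euler y k (x + y) + scaled_euler y k x = 2 * (x ^ k / fact k)"
proof -
  have "scaled_euler y k (x + y) + scaled_euler y k x =
      y ^ k * (euler_poly k (x / y + 1) + euler_poly k (x / y)) / fact k"
    using y by (simp add: scaled_euler_def add_divide_distrib algebra_simps)
  then show ?thesis
    using y by (simp add: euler_poly_shift_add power_divide)
qed

text \<open>The factor \<open>1 / y\<close> from the chain rule absorbs one power of
  \<open>y\<close>.\<close>

lemma has_real_derivative_scaled_euler: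
  "(scaled_euler y (Suc k) has_real_derivative scaled_euler y k x) (at x)"
proof -
  have "((\<lambda>x. y ^ Suc k * (euler_poly (Suc k) (x / y) / fact (Suc k))) has_real_derivative
      y ^ Suc k * (euler_poly k (x / y) / fact k * (1 / y))) (at x)"
    by (intro DERIV_cmult DERIV_chain2[where g = "\<lambda>x. x / y", OF has_real_derivative_euler_poly])
       (rule DERIV_cdivide[OF DERIV_ident])
  moreover have "y ^ Suc k * (euler_poly k (x / y) / fact k * (1 / y)) = scaled_euler y k x"
    using y by (simp add: scaled_euler_def)
  moreover have "(\<lambda>x. y ^ Suc k * (euler_poly (Suc k) (x / y) / fact (Suc k))) = scaled_euler y (Suc k)"
    by (rule ext) (simp add: scaled_euler_def del: fact_Suc)
  ultimately show ?thesis
    by simp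
qed

lemmas has_real_derivative_scaled_euler' [derivative_intros] =
  DERIV_chain2[OF has_real_derivative_scaled_euler]

lemma continuous_on_scaled_euler [continuous_intros]:
  assumes "continuous_on S f"
  shows "continuous_on S (\<lambda>t. scaled_euler y k (f t))"
proof -
  have "continuous_on UNIV (scaled_euler y k)"
  \<comment> \<open>Index 0 is separate, as the derivative rule covers successor indices
    only.\<close>
  proof (cases k)
    case 0
    then show ?thesis by simp
  next
    case (Suc j)
    then show ?thesis
      using has_field_derivative_at_within[OF has_real_derivative_scaled_euler]
      by (intro DERIV_continuous_on) auto
  qed
  then show ?thesis
    using assms by (rule continuous_on_compose2) simp
qed

end

section \<open>Calculus of oriented integrals, with endpoints in any order\<close>

lemma interval_integral_FTC_real:
  fixes f F :: "real \<Rightarrow> real"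
  assumes "continuous_on UNIV f" and "\<And>t. (F has_real_derivative f t) (at t)"
  shows "(LBINT t=ereal a..ereal b. f t) = F b - F a"
proof (rule interval_integral_FTC_finite)
  show "continuous_on {min a b..max a b} f"
    using assms(1) by (rule continuous_on_subset) simp
  show "(F has_vector_derivative f t) (at t within {min a b..max a b})" for t
    using assms(2) by (simp add: has_real_derivative_iff_has_vector_derivative
        has_vector_derivative_at_within)
qed

lemma interval_integrable_continuous_UNIV:
  fixes f :: "real \<Rightarrow> real"
  assumes "continuous_on UNIV f"
  shows "interval_lebesgue_integrable lborel (ereal a) (ereal b) f"
  using assms by (intro interval_integrable_isCont) (simp add: continuous_on_eq_continuous_at)

lemma interval_integral_by_parts:
  fixes f g F G :: "real \<Rightarrow> real"
  assumes cont: "continuous_on UNIV f" "continuous_on UNIV g"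
    and F: "\<And>t. (F has_real_derivative f t) (at t)"
    and G: "\<And>t. (G has_real_derivative g t) (at t)"
  shows "(LBINT t=ereal a..ereal b. F t * g t) =
    F b * G b - F a * G a - (LBINT t=ereal a..ereal b. f t * G t)"
proof -
  have FG: "continuous_on UNIV F" "continuous_on UNIV G"
    using F[THEN has_field_derivative_at_within] G[THEN has_field_derivative_at_within]
    by (blast intro: DERIV_continuous_on)+
  have "(LBINT t=ereal a..ereal b. F t * g t + f t * G t) = F b * G b - F a * G a"
    using cont FG DERIV_mult'[OF F G]
    by (intro interval_integral_FTC_real[where F = "\<lambda>t. F t * G t"] continuous_intros)
  moreover have "(LBINT t=ereal a..ereal b. F t * g t + f t * G t) =
      (LBINT t=ereal a..ereal b. F t * g t) + (LBINT t=ereal a..ereal b. f t * G t)"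
    using cont FG
    by (intro interval_lebesgue_integral_add(2) interval_integrable_continuous_UNIV continuous_intros)
  ultimately show ?thesis by simp
qed

section \<open>The convolution identity\<close>

lemma scaled_euler_convolution:
  assumes y: "y \<noteq> 0"
  shows "(LBINT t=ereal 0..ereal y. scaled_euler y m (x - t) * scaled_euler y n t)
      - 2 * (LBINT t=ereal x..ereal y. (x - t) ^ m / fact m * scaled_euler y n t)
    = 2 * scaled_euler y (m + n + 1) x"
\<comment> \<open>\<open>n\<close> is generalised because the step goes from the pair (m + 1, n) to
  (m, n + 1).\<close>
proof (induction m arbitrary: n)
  case 0
  have FTC: "(LBINT t=ereal a..ereal b. scaled_euler y n t) =
      scaled_euler y (Suc n) b - scaled_euler y (Suc n) a" for a b
    using y by (intro interval_integral_FTC_real continuous_intros has_real_derivative_scaled_euler)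
  \<comment> \<open>The right-hand side of the functional equation at 0 vanishes because the index
    is positive.\<close>
  have "scaled_euler y (Suc n) y + scaled_euler y (Suc n) 0 = 0"
    using scaled_euler_shift_add[OF y, of "Suc n" 0] by simp
  then show ?case
    by (simp add: FTC)
next
  case (Suc m)
  let ?b = "scaled_euler y"
  have antiperiodic: "?b (Suc n) 0 = - ?b (Suc n) y"
    using scaled_euler_shift_add[OF y, of "Suc n" 0] by simp
  have boundary: "?b (Suc m) x + ?b (Suc m) (x - y) = 2 * ((x - y) ^ Suc m / fact (Suc m))"
    using scaled_euler_shift_add[OF y, of "Suc m" "x - y"] by simp
  \<comment> \<open>Parts, integrating \<open>?b n\<close>. By \<open>antiperiodic\<close> the
    boundary terms become a sum, which \<open>boundary\<close> evaluates.\<close>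
  have "(LBINT t=ereal 0..ereal y. ?b (Suc m) (x - t) * ?b n t) =
      ?b (Suc m) (x - y) * ?b (Suc n) y - ?b (Suc m) (x - 0) * ?b (Suc n) 0
      - (LBINT t=ereal 0..ereal y. - ?b m (x - t) * ?b (Suc n) t)"
    using y by (intro interval_integral_by_parts)
      (auto intro!: continuous_intros derivative_eq_intros has_real_derivative_scaled_euler)
  also have "\<dots> = (?b (Suc m) x + ?b (Suc m) (x - y)) * ?b (Suc n) y
      + (LBINT t=ereal 0..ereal y. ?b m (x - t) * ?b (Suc n) t)"
    by (simp add: antiperiodic algebra_simps interval_lebesgue_integral_uminus)
  finally have I1: "(LBINT t=ereal 0..ereal y. ?b (Suc m) (x - t) * ?b n t) =
      2 * ((x - y) ^ Suc m / fact (Suc m)) * ?b (Suc n) y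
      + (LBINT t=ereal 0..ereal y. ?b m (x - t) * ?b (Suc n) t)"
    unfolding boundary .
  \<comment> \<open>The boundary term at \<open>t = x\<close> is zero; twice the one at
    \<open>t = y\<close> is exactly the boundary term of \<open>I1\<close>, so the two cancel in the
    difference.\<close>
  have "(LBINT t=ereal x..ereal y. (x - t) ^ Suc m / fact (Suc m) * ?b n t) =
      (x - y) ^ Suc m / fact (Suc m) * ?b (Suc n) y - (x - x) ^ Suc m / fact (Suc m) * ?b (Suc n) x
      - (LBINT t=ereal x..ereal y. - ((x - t) ^ m / fact m) * ?b (Suc n) t)"
  proof (rule interval_integral_by_parts)
    show "((\<lambda>t. (x - t) ^ Suc m / fact (Suc m)) has_real_derivative - ((x - t) ^ m / fact m)) (at t)"
      for t
    proof -
      have "((\<lambda>t. x - t) has_real_derivative -1) (at t)"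
        by (auto intro!: derivative_eq_intros)
      from DERIV_chain2[OF has_real_derivative_power_div_fact this] show ?thesis
        by (simp del: fact_Suc power_Suc)
    qed
  qed (use y in \<open>auto intro!: continuous_intros has_real_derivative_scaled_euler\<close>)
  then have I2: "(LBINT t=ereal x..ereal y. (x - t) ^ Suc m / fact (Suc m) * ?b n t) =
      (x - y) ^ Suc m / fact (Suc m) * ?b (Suc n) y
      + (LBINT t=ereal x..ereal y. (x - t) ^ m / fact m * ?b (Suc n) t)"
    by (simp add: interval_lebesgue_integral_uminus)
  show ?case
    using Suc.IH[of "Suc n"] unfolding I1 I2 by (simp add: algebra_simps)
qed

section \<open>The operation on scaled Euler polynomials\<close>

lemma scaled_euler_star:
  assumes y: "y \<noteq> 0"
  shows "((\<lambda>x y. scaled_euler y m x / 2) \<star> (\<lambda>x y. scaled_euler y n x / 2)) x y =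
    scaled_euler y (m + n + 1) x / 2"
proof -
  let ?b = "scaled_euler y"
  let ?f = "\<lambda>t. ?b n (x - t) * ?b m t" and ?g = "\<lambda>t. (x - t) ^ n / fact n * ?b m t"
  have cont: "continuous_on UNIV ?f" "continuous_on UNIV ?g"
    by (intro continuous_intros y | simp)+
  note int = interval_integrable_continuous_UNIV[OF cont(1)]
    interval_integrable_continuous_UNIV[OF cont(2)]
  \<comment> \<open>The functional equation at \<open>x - t\<close> brings both integrals of the
    operation to the argument \<open>x - t\<close>.\<close>
  have shift: "?b n (x + y - t) = 2 * ((x - t) ^ n / fact n) - ?b n (x - t)" for t
    using scaled_euler_shift_add[OF y, of n "x - t"] by (simp add: algebra_simps)
  have reflect: "?b m t / 2 * (?b n (x + y - t) / 2) = (1/2) * ?g t - (1/4) * ?f t" for t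
    by (simp add: shift field_simps)
  have "(LBINT t=ereal x..ereal y. ?b m t / 2 * (?b n (x + y - t) / 2)) =
      (LBINT t=ereal x..ereal y. (1/2) * ?g t) - (LBINT t=ereal x..ereal y. (1/4) * ?f t)"
    unfolding reflect
    by (intro interval_lebesgue_integral_diff(2) interval_lebesgue_integrable_mult_right int)
  also have "\<dots> = (1/2) * (LBINT t=ereal x..ereal y. ?g t) - (1/4) * (LBINT t=ereal x..ereal y. ?f t)"
    by (simp only: interval_lebesgue_integral_mult_right)
  finally have I: "(LBINT t=ereal x..ereal y. ?b m t / 2 * (?b n (x + y - t) / 2)) =
    (1/2) * (LBINT t=ereal x..ereal y. ?g t) - (1/4) * (LBINT t=ereal x..ereal y. ?f t)" .
  have "(LBINT t=ereal 0..ereal x. ?b m t / 2 * (?b n (x - t) / 2)) =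
      (LBINT t=ereal 0..ereal x. (1/4) * ?f t)"
    by (simp add: mult.commute)
  also have "\<dots> = (1/4) * (LBINT t=ereal 0..ereal x. ?f t)"
    by (simp only: interval_lebesgue_integral_mult_right)
  finally have J: "(LBINT t=ereal 0..ereal x. ?b m t / 2 * (?b n (x - t) / 2)) =
      (1/4) * (LBINT t=ereal 0..ereal x. ?f t)" .
  \<comment> \<open>The two pieces of \<open>?f\<close> join into one integral. As \<open>x\<close>
    may lie outside the interval from 0 to \<open>y\<close>, integrability is required on the hull
    of all three points.\<close>
  have "(LBINT t=ereal 0..ereal x. ?f t) + (LBINT t=ereal x..ereal y. ?f t) =
      (LBINT t=ereal 0..ereal y. ?f t)"
  proof (rule interval_integral_sum)
    have "min (ereal 0) (min (ereal x) (ereal y)) = ereal (min 0 (min x y))"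
      "max (ereal 0) (max (ereal x) (ereal y)) = ereal (max 0 (max x y))"
      by (simp_all only: ereal_min ereal_max)
    then show "interval_lebesgue_integrable lborel
        (min (ereal 0) (min (ereal x) (ereal y))) (max (ereal 0) (max (ereal x) (ereal y))) ?f"
      using int(1) by (simp only:)
  qed
  then show ?thesis
    \<comment> \<open>The indices are swapped because \<open>?f\<close> has \<open>n\<close> at
      \<open>x - t\<close>. The total is a quarter of the convolution expression, hence a quarter of
      \<open>2 * ?b (m + n + 1) x\<close>.\<close>
    using scaled_euler_convolution[OF y, of n x m, unfolded add.commute[of n m]]
    unfolding ast_op_def zero_ereal_def I J by linarith
qed

theorem theorem1p5:
  fixes m n :: nat
  assumes "m > 0" and "n > 0"
  shows "(\<forall>x::real.
           euler_poly (m + n + 1) x =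
             real ((m + n) choose m) * real (m + n + 1) / 2 *
             ((LBINT t=0..1. euler_poly m (x - t) * euler_poly n t)
              - 2 * (LBINT t=x..1. (x - t) ^ m * euler_poly n t)))
       \<and> (\<forall>x y::real. y > 0 \<longrightarrow>
           ((\<lambda>x y. y ^ m * euler_poly m (x / y) / (2 * fact m))
             \<star> (\<lambda>x y. y ^ n * euler_poly n (x / y) / (2 * fact n))) x y =
           y ^ (m + n + 1) * euler_poly (m + n + 1) (x / y) / (2 * fact (m + n + 1)))"
proof (intro conjI allI impI)
  fix x :: real
  \<comment> \<open>\<open>?c\<close> collects the factorials: at \<open>y = 1\<close> each scaled
    polynomial is E_k/k!, and the power of \<open>x - t\<close> carries 1/m!.\<close>
  let ?c = "1 / (fact m * fact n) :: real"
  let ?I = "LBINT t=ereal 0..ereal 1. euler_poly m (x - t) * euler_poly n t"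
  let ?J = "LBINT t=ereal x..ereal 1. (x - t) ^ m * euler_poly n t"
  have unscaled: "scaled_euler 1 k z = euler_poly k z / fact k" for k z
    by (simp add: scaled_euler_def)
  have "(LBINT t=ereal 0..ereal 1. scaled_euler 1 m (x - t) * scaled_euler 1 n t) =
      (LBINT t=ereal 0..ereal 1. ?c * (euler_poly m (x - t) * euler_poly n t))"
    "(LBINT t=ereal x..ereal 1. (x - t) ^ m / fact m * scaled_euler 1 n t) =
      (LBINT t=ereal x..ereal 1. ?c * ((x - t) ^ m * euler_poly n t))"
    by (simp_all add: unscaled)
  then have "?c * ?I - 2 * (?c * ?J) = 2 * (euler_poly (m + n + 1) x / fact (m + n + 1))"
    using scaled_euler_convolution[of 1 m x n]
    by (simp only: interval_lebesgue_integral_mult_right unscaled zero_neq_one[symmetric] not_False_eq_True)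
  then have "euler_poly (m + n + 1) x = fact (m + n + 1) * ?c / 2 * (?I - 2 * ?J)"
    by (simp add: field_simps del: fact_Suc)
  \<comment> \<open>Split (m+n+1)! as (m+n+1) (m+n)!.\<close>
  also have "fact (m + n + 1) * ?c = real ((m + n) choose m) * real (m + n + 1)"
    by (simp add: binomial_fact field_simps)
  finally show "euler_poly (m + n + 1) x = real ((m + n) choose m) * real (m + n + 1) / 2 *
      ((LBINT t=0..1. euler_poly m (x - t) * euler_poly n t)
       - 2 * (LBINT t=x..1. (x - t) ^ m * euler_poly n t))"
    by (simp only: zero_ereal_def one_ereal_def)
next
  fix x y :: real
  assume "y > 0"
  then show "((\<lambda>x y. y ^ m * euler_poly m (x / y) / (2 * fact m))
      \<star> (\<lambda>x y. y ^ n * euler_poly n (x / y) / (2 * fact n))) x y =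
      y ^ (m + n + 1) * euler_poly (m + n + 1) (x / y) / (2 * fact (m + n + 1))"
    using scaled_euler_star[of y m n x]
    by (simp add: scaled_euler_def mult.commute del: fact_Suc power_Suc)
qed

end
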